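(* Assume that one evaluation of $f$ costs $T_f=O(1)$ queries. Then, for integers $1\le h,w\le n$, the query complexity of the problem $LREC(f,n,h,w)$ (find an empty rectangle of the largest area among those of height at least $h$ and width at least $w$, for $f:\{0,\dots,n-1\}\times\{0,\dots,n-1\}\to\{0,1\}$) is $\Omega(n^2)$ in the classical (deterministic or randomized) case and $\Omega(n)$ in the quantum case.
   Context: Problem $LREC(f,n,h,w)$ (Largest Empty Rectangle): given $f:\{0,\dots,n-1\}^2\to\{0,1\}$ and integers $h,w$, a quadruple $(x_1,y_1,x_2,y_2)$ with $0\le x_1\le x_2\le n-1$ and $0\le y_1\le y_2\le n-1$ is an empty rectangle if $f(i,j)=0$ for all $x_1\le i\le x_2$, $y_1\le j\le y_2$, and moreover $y_2-y_1+1\ge h$ and $x_2-x_1+1\ge w$. Its size (area) is $(x_2-x_1+1)(y_2-y_1+1)$. The goal is to output an empty rectangle such that no other empty rectangle has larger size (if there is none, output $(NULL,NULL,NULL,NULL)$). Query model: the input is the table of values of $f$, and a query reveals one value $f(i,j)$. In the quantum case a query is one application of the unitary $|i,j\rangle|z\rangle|w\rangle\mapsto|i,j\rangle|z+f(i,j) \bmod 2\rangle|w\rangle$, interleaved with arbitrary input-independent unitaries and followed by a final measurement. The (randomized or quantum) query complexity of the problem is the smallest worst-case number of queries of an algorithm that, on every input, outputs a correct answer with probability at least $2/3$. *)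

theory Defs
  imports "HOL-Probability.Probability" "HOL-Library.Landau_Symbols"
begin

text \<open>A table \<open>f : {0, \<dots>, n-1}\<^sup>2 \<rightarrow> {0, 1}\<close> is a function \<open>nat \<Rightarrow> nat \<Rightarrow> bool\<close> (\<open>True\<close> is 1); only its
  values on the grid are ever used.\<close>

type_synonym table = "nat \<Rightarrow> nat \<Rightarrow> bool"
type_synonym rect = "nat \<times> nat \<times> nat \<times> nat"

definition empty_rect :: "nat \<Rightarrow> nat \<Rightarrow> nat \<Rightarrow> table \<Rightarrow> rect \<Rightarrow> bool" where
  "empty_rect n h w f = (\<lambda>(x1, y1, x2, y2).
     x1 \<le> x2 \<and> x2 \<le> n - 1 \<and> y1 \<le> y2 \<and> y2 \<le> n - 1 \<and>
     (\<forall>i j. x1 \<le> i \<and> i \<le> x2 \<and> y1 \<le> j \<and> j \<le> y2 \<longrightarrow> \<not> f i j) \<and>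
     h \<le> y2 - y1 + 1 \<and> w \<le> x2 - x1 + 1)"

definition area :: "rect \<Rightarrow> nat" where
  "area = (\<lambda>(x1, y1, x2, y2). (x2 - x1 + 1) * (y2 - y1 + 1))"

text \<open>The answer \<open>None\<close> stands for (NULL, NULL, NULL, NULL).\<close>

definition LREC_answer :: "nat \<Rightarrow> nat \<Rightarrow> nat \<Rightarrow> table \<Rightarrow> rect option \<Rightarrow> bool" where
  "LREC_answer n h w f ans \<longleftrightarrow>
     (case ans of
        None \<Rightarrow> \<nexists>r. empty_rect n h w f r
      | Some r \<Rightarrow> empty_rect n h w f r \<and> (\<forall>r'. empty_rect n h w f r' \<longrightarrow> area r' \<le> area r))"

text \<open>Classical algorithms are decision trees: \<open>Query i j t0 t1\<close> evaluates \<open>f i j\<close> and continues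
  with \<open>t0\<close> if the value is 0 and with \<open>t1\<close> if it is 1.\<close>

datatype dtree = Output "rect option" | Query nat nat dtree dtree

primrec on_grid :: "nat \<Rightarrow> dtree \<Rightarrow> bool" where
  "on_grid n (Output a) \<longleftrightarrow> True"
| "on_grid n (Query i j t0 t1) \<longleftrightarrow> i < n \<and> j < n \<and> on_grid n t0 \<and> on_grid n t1"

primrec run :: "table \<Rightarrow> dtree \<Rightarrow> rect option" where
  "run f (Output a) = a"
| "run f (Query i j t0 t1) = (if f i j then run f t1 else run f t0)"

primrec evaluations :: "table \<Rightarrow> dtree \<Rightarrow> nat" where
  "evaluations f (Output a) = 0"
| "evaluations f (Query i j t0 t1) = Suc (if f i j then evaluations f t1 else evaluations f t0)"

definition deterministic_LREC :: "nat \<Rightarrow> nat \<Rightarrow> nat \<Rightarrow> nat \<Rightarrow> bool" where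
  "deterministic_LREC n h w q \<longleftrightarrow>
     (\<exists>t. on_grid n t \<and> (\<forall>f. evaluations f t \<le> q) \<and> (\<forall>f. LREC_answer n h w f (run f t)))"

text \<open>A randomized algorithm is a probability distribution on decision trees. There are only
  countably many trees, so \<open>dtree pmf\<close> covers all such distributions.\<close>

definition randomized_LREC :: "nat \<Rightarrow> nat \<Rightarrow> nat \<Rightarrow> nat \<Rightarrow> bool" where
  "randomized_LREC n h w q \<longleftrightarrow>
     (\<exists>p :: dtree pmf. (\<forall>t \<in> set_pmf p. on_grid n t \<and> (\<forall>f. evaluations f t \<le> q)) \<and>
       (\<forall>f. measure_pmf.prob p {t. LREC_answer n h w f (run f t)} \<ge> 2/3))"

text \<open>The basis states \<open>|i,j\<rangle>|z\<rangle>|v\<rangle>\<close> of a quantum algorithm with a \<open>d\<close>-dimensional workspace are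
  the tuples \<open>(i, j, z, v)\<close> in \<open>qbasis n d\<close>. A state is given by its amplitudes and an operator by
  its matrix entries; values at tuples outside \<open>qbasis n d\<close> are irrelevant.\<close>

type_synonym qindex = "nat \<times> nat \<times> bool \<times> nat"
type_synonym qstate = "qindex \<Rightarrow> complex"
type_synonym qoperator = "qindex \<Rightarrow> qindex \<Rightarrow> complex"

definition qbasis :: "nat \<Rightarrow> nat \<Rightarrow> qindex set" where
  "qbasis n d = {0..<n} \<times> {0..<n} \<times> UNIV \<times> {0..<d}"

definition unitary_on :: "qindex set \<Rightarrow> qoperator \<Rightarrow> bool" where
  "unitary_on B U \<longleftrightarrow>
     (\<forall>a \<in> B. \<forall>b \<in> B. (\<Sum>c \<in> B. cnj (U c a) * U c b) = (if a = b then 1 else 0)) \<and>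
     (\<forall>a \<in> B. \<forall>b \<in> B. (\<Sum>c \<in> B. U a c * cnj (U b c)) = (if a = b then 1 else 0))"

definition qapply :: "qindex set \<Rightarrow> qoperator \<Rightarrow> qstate \<Rightarrow> qstate" where
  "qapply B U \<psi> = (\<lambda>a. \<Sum>b \<in> B. U a b * \<psi> b)"

text \<open>Addition modulo 2 on \<open>bool\<close> is \<open>\<noteq>\<close>. The oracle is an involution on the basis, so the new
  amplitude at a basis state is the old amplitude at its image.\<close>

definition qoracle :: "table \<Rightarrow> qstate \<Rightarrow> qstate" where
  "qoracle f \<psi> = (\<lambda>(i, j, z, v). \<psi> (i, j, z \<noteq> f i j, v))"

primrec qrun :: "qindex set \<Rightarrow> (nat \<Rightarrow> qoperator) \<Rightarrow> table \<Rightarrow> nat \<Rightarrow> qstate" where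
  "qrun B U f 0 = qapply B (U 0) (\<lambda>b. if b = (0, 0, False, 0) then 1 else 0)"
| "qrun B U f (Suc k) = qapply B (U (Suc k)) (qoracle f (qrun B U f k))"

text \<open>The final measurement is in the standard basis, with classical post-processing \<open>out\<close>; as the
  last unitary and the workspace are arbitrary, this covers every measurement.\<close>

definition quantum_LREC :: "nat \<Rightarrow> nat \<Rightarrow> nat \<Rightarrow> nat \<Rightarrow> bool" where
  "quantum_LREC n h w q \<longleftrightarrow>
     (\<exists>d U (out :: qindex \<Rightarrow> rect option). d \<ge> 1 \<and> (\<forall>k \<le> q. unitary_on (qbasis n d) (U k)) \<and>
       (\<forall>f. (\<Sum>b \<in> {b \<in> qbasis n d. LREC_answer n h w f (out b)}.
               (cmod (qrun (qbasis n d) U f q b))\<^sup>2) \<ge> 2/3))"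

text \<open>\<open>query_complexity T P\<close> is the smallest number of queries sufficient for algorithms of kind
  \<open>P\<close>, where \<open>P q\<close> means that \<open>q\<close> evaluations of the input function suffice and each evaluation
  costs \<open>T\<close> queries. It would be \<open>\<infinity>\<close> if no algorithm existed.\<close>

definition query_complexity :: "nat \<Rightarrow> (nat \<Rightarrow> bool) \<Rightarrow> enat" where
  "query_complexity T P = (INF q \<in> {q. P q}. enat (T * q))"

end

theory Submission
  imports Defs
begin

text \<open>The only correct answer for the all-zero table is the whole grid, and that answer becomes wrong
  as soon as a single cell is set to 1; this holds for every \<open>h\<close> and \<open>w\<close>. So an algorithm has to
  notice a single 1 among \<open>n\<^sup>2\<close> cells. A randomized algorithm must therefore look at each cell with
  probability at least 1/3 when it runs on the all-zero table, which costs \<open>n\<^sup>2/3\<close> queries. For a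
  quantum algorithm the hybrid argument bounds the distance of the final states for the two tables
  by twice the sum, over all queries, of the norms of the part of the query state (for the all-zero
  table) that sits on the changed cell. Averaging the square over all cells gives
  \<open>n\<^sup>2/25 \<le> 4 q\<^sup>2\<close>.\<close>

section \<open>Correct answers for the all-zero table and its one-cell changes\<close>

definition zero_table :: table where
  "zero_table = (\<lambda>_ _. False)"

definition single_one :: "nat \<times> nat \<Rightarrow> table" where
  "single_one c = (\<lambda>i j. (i, j) = c)"

definition whole_grid :: "nat \<Rightarrow> rect" where
  "whole_grid n = (0, 0, n - 1, n - 1)"

lemma empty_rect_whole_grid_zero_table:
  assumes "h \<le> n" "w \<le> n"
  shows "empty_rect n h w zero_table (whole_grid n)"
  using assms by (auto simp: empty_rect_def whole_grid_def zero_table_def)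

text \<open>The whole grid is admissible, so \<open>None\<close> is wrong and an optimal rectangle
  has area at least \<open>n * n\<close>. Its sides have length at most \<open>n\<close>, so both
  must equal \<open>n\<close>.\<close>

lemma LREC_answer_zero_tableD:
  assumes "1 \<le> n" "h \<le> n" "w \<le> n" and ans: "LREC_answer n h w zero_table ans"
  shows "ans = Some (whole_grid n)"
proof (cases ans)
  case None
  then show ?thesis
    using ans empty_rect_whole_grid_zero_table[OF assms(2,3)]
    by (simp add: LREC_answer_def del: split_paired_All split_paired_Ex)
next
  case (Some r)
  obtain x1 y1 x2 y2 where r: "r = (x1, y1, x2, y2)"
    by (cases r)
  have E: "empty_rect n h w zero_table r" and "area (whole_grid n) \<le> area r"
    using ans empty_rect_whole_grid_zero_table[OF assms(2,3)] Some
    by (simp_all add: LREC_answer_def del: split_paired_All split_paired_Ex)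
  then have area: "n * n \<le> (x2 - x1 + 1) * (y2 - y1 + 1)"
    using \<open>1 \<le> n\<close> by (simp add: area_def whole_grid_def r del: add_Suc_right mult_Suc_right mult_Suc)
  have b: "x1 \<le> x2" "x2 \<le> n - 1" "y1 \<le> y2" "y2 \<le> n - 1"
    using E by (auto simp: empty_rect_def r)
  have le: "x2 - x1 + 1 \<le> n" "y2 - y1 + 1 \<le> n"
    using b \<open>1 \<le> n\<close> by linarith+
  \<comment> \<open>Enlarging one factor of the area to \<open>n\<close> leaves a bound from which
    \<open>n\<close> can be cancelled.\<close>
  have "n * n \<le> (x2 - x1 + 1) * n" "n * n \<le> n * (y2 - y1 + 1)"
    using area mult_le_mono2[OF le(2)] mult_le_mono1[OF le(1)] le_trans by blast+
  then have "n \<le> x2 - x1 + 1" "n \<le> y2 - y1 + 1"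
    using \<open>1 \<le> n\<close> unfolding mult_le_cancel1 mult_le_cancel2 by linarith+
  then show ?thesis
    using b Some \<open>1 \<le> n\<close> by (auto simp: r whole_grid_def)
qed

lemma LREC_answer_whole_gridD:
  assumes "LREC_answer n h w f (Some (whole_grid n))" "i < n" "j < n"
  shows "\<not> f i j"
proof -
  have "empty_rect n h w f (whole_grid n)"
    using assms(1) by (simp add: LREC_answer_def)
  moreover have "i \<le> n - 1" "j \<le> n - 1"
    using assms(2,3) by linarith+
  ultimately show ?thesis
    by (simp add: empty_rect_def whole_grid_def)
qed

text \<open>A nonempty set in \<open>enat\<close> attains its infimum, so a bound on every
  sufficient \<open>q\<close> carries over, and \<open>T\<close> at least 1 can only enlarge the
  cost. If no \<open>q\<close> suffices, the infimum is infinite.\<close>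

lemma query_complexity_ge:
  assumes "1 \<le> T" and "\<And>q. P q \<Longrightarrow> c \<le> real q"
  shows "ereal c \<le> ereal_of_enat (query_complexity T P)"
proof (cases "\<exists>q. P q")
  case True
  then have "(\<lambda>q. enat (T * q)) ` {q. P q} \<noteq> {}"
    by auto
  then have "query_complexity T P \<in> (\<lambda>q. enat (T * q)) ` {q. P q}"
    unfolding query_complexity_def Inf_enat_def by (auto intro: LeastI)
  then obtain q where q: "P q" "query_complexity T P = enat (T * q)"
    by auto
  have "1 * q \<le> T * q"
    using \<open>1 \<le> T\<close> by (rule mult_le_mono1)
  then have "real q \<le> real (T * q)"
    by (metis mult_1 of_nat_le_iff)
  then show ?thesis
    using assms(2)[OF q(1)] q(2) by simp
next
  case False
  then show ?thesis
    by (simp add: query_complexity_def Inf_enat_def)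
qed


subsection \<open>Classical algorithms\<close>

primrec queried :: "table \<Rightarrow> dtree \<Rightarrow> (nat \<times> nat) set" where
  "queried f (Output a) = {}"
| "queried f (Query i j t0 t1) = insert (i, j) (if f i j then queried f t1 else queried f t0)"

lemma finite_queried: "finite (queried f t)"
  by (induction t) auto

text \<open>Equality can fail because a tree may query the same cell repeatedly.\<close>

lemma card_queried_le: "card (queried f t) \<le> evaluations f t"
  by (induction t) (auto simp: finite_queried intro: card_insert_le_m1 le_trans[OF card_insert_le_m1])

text \<open>Agreement along the path that \<open>f\<close> takes makes \<open>g\<close> take the
  same branches, hence reach the same leaf.\<close>

lemma run_cong:
  assumes "\<And>i j. (i, j) \<in> queried f t \<Longrightarrow> g i j = f i j"
  shows "run g t = run f t"
  using assms by (induction t) (auto split: if_splits)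

text \<open>Double counting: by linearity of expectation the sum is the expected size of
  \<open>C \<inter> Q x\<close>, which is almost surely at most \<open>q\<close>.\<close>

lemma (in prob_space) sum_prob_le_of_card_le:
  assumes "finite C" and "\<And>c. c \<in> C \<Longrightarrow> {x \<in> space M. c \<in> Q x} \<in> events"
    and "AE x in M. card (C \<inter> Q x) \<le> q"
  shows "(\<Sum>c\<in>C. prob {x \<in> space M. c \<in> Q x}) \<le> real q"
proof -
  let ?I = "\<lambda>c x. indicator {x \<in> space M. c \<in> Q x} x :: real"
  have int: "integrable M (?I c)" if "c \<in> C" for c
    using assms(2)[OF that] by (simp add: integrable_real_indicator emeasure_eq_measure)
  have "(\<Sum>c\<in>C. prob {x \<in> space M. c \<in> Q x}) = (\<Sum>c\<in>C. expectation (?I c))"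
    using assms(2) by (intro sum.cong) auto
  also have "\<dots> = expectation (\<lambda>x. \<Sum>c\<in>C. ?I c x)"
    using int by (intro Bochner_Integration.integral_sum[symmetric])
  also have "\<dots> \<le> expectation (\<lambda>_. real q)"
  proof (rule integral_mono_AE)
    show "integrable M (\<lambda>x. \<Sum>c\<in>C. ?I c x)"
      using int by (rule Bochner_Integration.integrable_sum)
    show "AE x in M. (\<Sum>c\<in>C. ?I c x) \<le> real q"
      using assms(3) AE_space
    proof eventually_elim
      case (elim x)
      have "(\<Sum>c\<in>C. ?I c x) = (\<Sum>c\<in>C. if c \<in> Q x then 1 else 0)"
        using elim by (intro sum.cong) (auto simp: indicator_def)
      also have "\<dots> = real (card (C \<inter> Q x))"
        using \<open>finite C\<close> by (simp add: sum.If_cases)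
      finally show ?case
        using elim by simp
    qed
  qed simp
  also have "\<dots> = real q"
    by (simp add: prob_space)
  finally show ?thesis .
qed

lemma randomized_LREC_ge:
  assumes "1 \<le> n" "h \<le> n" "w \<le> n" and "randomized_LREC n h w q"
  shows "1 / 3 * real n ^ 2 \<le> real q"
proof -
  obtain p :: "dtree pmf" where
    evals: "\<And>t f. t \<in> set_pmf p \<Longrightarrow> evaluations f t \<le> q" and
    correct: "\<And>f. measure_pmf.prob p {t. LREC_answer n h w f (run f t)} \<ge> 2 / 3"
    using assms(4) by (auto simp: randomized_LREC_def)
  let ?C = "{0..<n} \<times> {0..<n}"
  have "1 / 3 \<le> measure_pmf.prob p {t. c \<in> queried zero_table t}" if "c \<in> ?C" for c
  proof -
    let ?A = "{t. LREC_answer n h w zero_table (run zero_table t)}"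
    let ?B = "{t. LREC_answer n h w (single_one c) (run (single_one c) t)}"
    \<comment> \<open>A tree that misses \<open>c\<close> on the zero table cannot tell the two
      tables apart, so it cannot be right on both.\<close>
    have "?A \<inter> ?B \<subseteq> {t. c \<in> queried zero_table t}"
    proof safe
      fix t
      assume A: "LREC_answer n h w zero_table (run zero_table t)"
        and B: "LREC_answer n h w (single_one c) (run (single_one c) t)"
      show "c \<in> queried zero_table t"
      proof (rule ccontr)
        assume "c \<notin> queried zero_table t"
        then have "run (single_one c) t = run zero_table t"
          by (intro run_cong) (auto simp: single_one_def zero_table_def)
        also have "\<dots> = Some (whole_grid n)"
          using LREC_answer_zero_tableD[OF assms(1-3) A] .
        finally have "LREC_answer n h w (single_one c) (Some (whole_grid n))"
          using B by simp
        then have "\<not> single_one c (fst c) (snd c)"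
          by (rule LREC_answer_whole_gridD) (use \<open>c \<in> ?C\<close> in auto)
        then show False
          by (simp add: single_one_def)
      qed
    qed
    then have "measure_pmf.prob p (?A \<inter> ?B) \<le> measure_pmf.prob p {t. c \<in> queried zero_table t}"
      by (intro measure_pmf.finite_measure_mono) auto
    \<comment> \<open>Inclusion-exclusion gives the intersection probability at least 2/3 + 2/3 - 1
      = 1/3.\<close>
    moreover have "measure_pmf.prob p (?A \<union> ?B) =
        measure_pmf.prob p ?A + measure_pmf.prob p ?B - measure_pmf.prob p (?A \<inter> ?B)"
      by (rule measure_Un3) (auto simp: measure_pmf.fmeasurable_eq_sets)
    ultimately show ?thesis
      using correct[of zero_table] correct[of "single_one c"] measure_pmf.prob_le_1[of p "?A \<union> ?B"]
      by linarith
  qed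
  then have "(\<Sum>c\<in>?C. 1 / 3) \<le> (\<Sum>c\<in>?C. measure_pmf.prob p {t. c \<in> queried zero_table t})"
    by (rule sum_mono)
  also have "\<dots> \<le> real q"
  proof -
    have "card (?C \<inter> queried zero_table t) \<le> q" if "t \<in> set_pmf p" for t
      using card_mono[OF finite_queried, of "?C \<inter> queried zero_table t" zero_table t]
        card_queried_le[of zero_table t] evals[OF that, of zero_table] by simp
    then show ?thesis
      using measure_pmf.sum_prob_le_of_card_le[of ?C p "queried zero_table" q]
      by (simp add: AE_measure_pmf_iff)
  qed
  finally show ?thesis
    by (simp add: power2_eq_square)
qed

lemma deterministic_imp_randomized_LREC:
  assumes "deterministic_LREC n h w q"
  shows "randomized_LREC n h w q"
proof -
  obtain t where "on_grid n t" "\<And>f. evaluations f t \<le> q" "\<And>f. LREC_answer n h w f (run f t)"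
    using assms by (auto simp: deterministic_LREC_def)
  then show ?thesis
    unfolding randomized_LREC_def by (intro exI[of _ "return_pmf t"]) simp
qed


subsection \<open>Quantum algorithms\<close>

abbreviation qnorm :: "qindex set \<Rightarrow> qstate \<Rightarrow> real" where
  "qnorm B \<psi> \<equiv> L2_set (\<lambda>b. cmod (\<psi> b)) B"

lemma qnorm_power2: "(qnorm B \<psi>)\<^sup>2 = (\<Sum>b\<in>B. (cmod (\<psi> b))\<^sup>2)"
  by (simp add: L2_set_def sum_nonneg)

lemma qnorm_triangle: "qnorm B (\<lambda>b. \<psi> b + \<phi> b) \<le> qnorm B \<psi> + qnorm B \<phi>"
proof -
  have "qnorm B (\<lambda>b. \<psi> b + \<phi> b) \<le> L2_set (\<lambda>b. cmod (\<psi> b) + cmod (\<phi> b)) B"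
    by (rule L2_set_mono) (auto intro: norm_triangle_ineq)
  also have "\<dots> \<le> qnorm B \<psi> + qnorm B \<phi>"
    by (rule L2_set_triangle_ineq)
  finally show ?thesis .
qed

lemma qnorm_minus_le: "qnorm B (\<lambda>b. \<psi> b - \<phi> b) \<le> qnorm B \<psi> + qnorm B \<phi>"
  using qnorm_triangle[of \<psi> "\<lambda>b. - \<phi> b" B] by simp

lemma qnorm_mono: "finite B \<Longrightarrow> S \<subseteq> B \<Longrightarrow> qnorm S \<psi> \<le> qnorm B \<psi>"
  unfolding L2_set_def by (intro real_sqrt_le_mono sum_mono2) auto

lemma qapply_diff: "qapply B U (\<lambda>b. \<psi> b - \<phi> b) = (\<lambda>a. qapply B U \<psi> a - qapply B U \<phi> a)"
  by (simp add: qapply_def right_diff_distrib sum_subtractf)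

text \<open>Expanding the squared norm produces the inner products of the columns of
  \<open>U\<close>; their orthonormality leaves only the diagonal terms. The computation is done
  over the complex numbers, where a squared modulus is the product of a number and its
  conjugate.\<close>

lemma qnorm_qapply:
  assumes "finite B" "unitary_on B U"
  shows "qnorm B (qapply B U \<psi>) = qnorm B \<psi>"
proof -
  have "complex_of_real (\<Sum>c\<in>B. (cmod (qapply B U \<psi> c))\<^sup>2) =
      (\<Sum>c\<in>B. \<Sum>b\<in>B. \<Sum>a\<in>B. (U c b * \<psi> b) * cnj (U c a * \<psi> a))"
    by (simp add: complex_norm_square qapply_def sum_product del: complex_cnj_mult of_real_power)
  also have "\<dots> = (\<Sum>b\<in>B. \<Sum>c\<in>B. \<Sum>a\<in>B. (U c b * \<psi> b) * cnj (U c a * \<psi> a))"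
    by (rule sum.swap)
  also have "\<dots> = (\<Sum>b\<in>B. \<Sum>a\<in>B. \<Sum>c\<in>B. (U c b * \<psi> b) * cnj (U c a * \<psi> a))"
    by (intro sum.cong refl sum.swap)
  also have "\<dots> = (\<Sum>b\<in>B. \<Sum>a\<in>B. \<psi> b * cnj (\<psi> a) * (\<Sum>c\<in>B. cnj (U c a) * U c b))"
    by (simp add: sum_distrib_left mult_ac)
  also have "\<dots> = (\<Sum>b\<in>B. \<Sum>a\<in>B. if a = b then \<psi> b * cnj (\<psi> a) else 0)"
    using assms(2) by (intro sum.cong refl) (simp add: unitary_on_def)
  also have "\<dots> = complex_of_real (\<Sum>b\<in>B. (cmod (\<psi> b))\<^sup>2)"
    using assms(1) by (simp add: complex_norm_square del: of_real_power)
  finally show ?thesis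
    unfolding L2_set_def of_real_eq_iff by simp
qed

section \<open>The oracle and its distance from the identity\<close>

lemma finite_qbasis: "finite (qbasis n d)"
  by (simp add: qbasis_def)

text \<open>These are the basis states that the oracle for \<open>f\<close> moves. For
  \<open>single_one c\<close> they are the states whose query register holds
  \<open>c\<close>.\<close>

definition at_ones :: "nat \<Rightarrow> nat \<Rightarrow> table \<Rightarrow> qindex set" where
  "at_ones n d f = {b \<in> qbasis n d. f (fst b) (fst (snd b))}"

lemma at_ones_subset: "at_ones n d f \<subseteq> qbasis n d"
  by (auto simp: at_ones_def)

text \<open>The oracle permutes the basis by an involution, which restricts to a bijection of any
  set \<open>S\<close> closed under it. It is needed both for the whole basis and for
  \<open>at_ones\<close>.\<close>

lemma qnorm_qoracle_invariant:
  assumes "\<And>i j z v. (i, j, z, v) \<in> S \<Longrightarrow> (i, j, z \<noteq> f i j, v) \<in> S"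
  shows "qnorm S (qoracle f \<psi>) = qnorm S \<psi>"
proof -
  let ?\<sigma> = "\<lambda>(i, j, z, v). (i, j, z \<noteq> f i j, v)"
  have "(\<Sum>b\<in>S. (cmod (qoracle f \<psi> b))\<^sup>2) = (\<Sum>b\<in>S. (cmod (\<psi> b))\<^sup>2)"
    by (rule sum.reindex_bij_witness[of _ ?\<sigma> ?\<sigma>]) (auto simp: qoracle_def dest: assms)
  then show ?thesis
    by (simp add: L2_set_def)
qed

lemma qnorm_qoracle: "qnorm (qbasis n d) (qoracle f \<psi>) = qnorm (qbasis n d) \<psi>"
  by (rule qnorm_qoracle_invariant) (auto simp: qbasis_def)

lemma qoracle_diff: "qoracle f (\<lambda>b. \<psi> b - \<phi> b) = (\<lambda>b. qoracle f \<psi> b - qoracle f \<phi> b)"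
  by (auto simp: qoracle_def)

lemma qoracle_zero_table: "qoracle zero_table \<psi> = \<psi>"
  by (auto simp: qoracle_def zero_table_def)

text \<open>Amplitudes outside \<open>at_ones\<close> do not change. Inside it, both terms of the
  difference have the same norm, whence the factor 2.\<close>

lemma qnorm_qoracle_minus_le:
  "qnorm (qbasis n d) (\<lambda>b. qoracle f \<psi> b - \<psi> b) \<le> 2 * qnorm (at_ones n d f) \<psi>"
proof -
  have "qnorm (qbasis n d) (\<lambda>b. qoracle f \<psi> b - \<psi> b) = qnorm (at_ones n d f) (\<lambda>b. qoracle f \<psi> b - \<psi> b)"
  proof -
    have "qoracle f \<psi> b = \<psi> b" if "b \<in> qbasis n d - at_ones n d f" for b
      using that by (cases b) (simp add: at_ones_def qoracle_def)
    then show ?thesis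
      unfolding L2_set_def
      by (intro arg_cong[of _ _ sqrt] sum.mono_neutral_right)
        (simp_all add: finite_qbasis at_ones_subset)
  qed
  also have "\<dots> \<le> qnorm (at_ones n d f) (qoracle f \<psi>) + qnorm (at_ones n d f) \<psi>"
    by (rule qnorm_minus_le)
  also have "qnorm (at_ones n d f) (qoracle f \<psi>) = qnorm (at_ones n d f) \<psi>"
    by (rule qnorm_qoracle_invariant) (auto simp: at_ones_def qbasis_def)
  finally show ?thesis
    by simp
qed

section \<open>Comparison of the runs on two tables\<close>

lemma qnorm_qrun:
  assumes "1 \<le> n" "1 \<le> d" "\<And>m. m \<le> k \<Longrightarrow> unitary_on (qbasis n d) (U m)"
  shows "qnorm (qbasis n d) (qrun (qbasis n d) U f k) = 1"
  using assms(3)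
proof (induction k)
  case 0
  have "(0, 0, False, 0) \<in> qbasis n d"
    using assms(1,2) by (simp add: qbasis_def)
  then have "qnorm (qbasis n d) (\<lambda>b. if b = (0, 0, False, 0) then 1 else 0) = 1"
    using finite_qbasis[of n d] by (simp add: L2_set_def if_distrib[of cmod] if_distrib[of "\<lambda>x. x\<^sup>2"]
      cong: if_cong)
  then show ?case
    using 0 by (simp add: qnorm_qapply finite_qbasis)
next
  case (Suc k)
  then show ?case
    by (simp add: qnorm_qapply finite_qbasis qnorm_qoracle)
qed

lemma hybrid_argument:
  assumes "\<And>m. m \<le> k \<Longrightarrow> unitary_on (qbasis n d) (U m)"
  shows "qnorm (qbasis n d) (\<lambda>b. qrun (qbasis n d) U f k b - qrun (qbasis n d) U zero_table k b)
    \<le> 2 * (\<Sum>m<k. qnorm (at_ones n d f) (qrun (qbasis n d) U zero_table m))"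
  using assms
proof (induction k)
  case 0
  show ?case
    by (simp add: L2_set_def)
next
  case (Suc k)
  let ?B = "qbasis n d"
  let ?\<phi> = "qrun ?B U f k" and ?\<psi> = "qrun ?B U zero_table k"
  have "qnorm ?B (\<lambda>b. qrun ?B U f (Suc k) b - qrun ?B U zero_table (Suc k) b) =
      qnorm ?B (qapply ?B (U (Suc k)) (\<lambda>b. qoracle f ?\<phi> b - ?\<psi> b))"
    by (simp only: qrun.simps qoracle_zero_table qapply_diff)
  also have "\<dots> = qnorm ?B (\<lambda>b. qoracle f ?\<phi> b - ?\<psi> b)"
    using Suc.prems[of "Suc k"] by (simp add: qnorm_qapply finite_qbasis)
  \<comment> \<open>Inserting \<open>qoracle f\<close> applied to the zero-table state separates the
    old error, whose norm the oracle preserves, from the error newly made by this query.\<close>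
  also have "\<dots> = qnorm ?B (\<lambda>b. qoracle f (\<lambda>b. ?\<phi> b - ?\<psi> b) b + (qoracle f ?\<psi> b - ?\<psi> b))"
    by (simp add: qoracle_diff)
  also have "\<dots> \<le> qnorm ?B (qoracle f (\<lambda>b. ?\<phi> b - ?\<psi> b)) + qnorm ?B (\<lambda>b. qoracle f ?\<psi> b - ?\<psi> b)"
    by (rule qnorm_triangle)
  also have "\<dots> \<le> qnorm ?B (\<lambda>b. ?\<phi> b - ?\<psi> b) + 2 * qnorm (at_ones n d f) ?\<psi>"
    by (simp only: qnorm_qoracle add_left_mono qnorm_qoracle_minus_le)
  also have "\<dots> \<le> 2 * (\<Sum>m<Suc k. qnorm (at_ones n d f) (qrun ?B U zero_table m))"
    using Suc by simp
  finally show ?case .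
qed

text \<open>The content of the query register partitions the basis into these sets, one for each
  cell.\<close>

lemma sum_qnorm_at_single_one:
  "(\<Sum>c\<in>{0..<n} \<times> {0..<n}. (qnorm (at_ones n d (single_one c)) \<psi>)\<^sup>2) = (qnorm (qbasis n d) \<psi>)\<^sup>2"
proof -
  have "{b \<in> qbasis n d. (fst b, fst (snd b)) = c} = at_ones n d (single_one c)" for c
    by (simp add: at_ones_def single_one_def)
  moreover have "(\<lambda>b. (fst b, fst (snd b))) ` qbasis n d \<subseteq> {0..<n} \<times> {0..<n}"
    by (auto simp: qbasis_def)
  ultimately show ?thesis
    using sum.group[of "qbasis n d" "{0..<n} \<times> {0..<n}" "\<lambda>b. (fst b, fst (snd b))"
      "\<lambda>b. (cmod (\<psi> b))\<^sup>2"]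
    by (simp add: qnorm_power2 finite_qbasis)
qed

section \<open>The quantum lower bound\<close>

lemma quantum_LREC_ge:
  assumes "1 \<le> n" "h \<le> n" "w \<le> n" and "quantum_LREC n h w q"
  shows "1 / 10 * real n \<le> real q"
proof -
  obtain d U and out :: "qindex \<Rightarrow> rect option" where
    d: "d \<ge> 1" and U: "\<And>k. k \<le> q \<Longrightarrow> unitary_on (qbasis n d) (U k)" and
    correct: "\<And>f. (\<Sum>b \<in> {b \<in> qbasis n d. LREC_answer n h w f (out b)}.
               (cmod (qrun (qbasis n d) U f q b))\<^sup>2) \<ge> 2 / 3"
    using assms(4) by (auto simp: quantum_LREC_def)
  let ?B = "qbasis n d" and ?C = "{0..<n} \<times> {0..<n}"
  let ?\<psi> = "qrun ?B U zero_table"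
  let ?D = "\<lambda>c. qnorm ?B (\<lambda>b. qrun ?B U (single_one c) q b - ?\<psi> q b)"
  \<comment> \<open>\<open>S\<close> collects the outcomes reporting the whole grid: likely for the
    zero table, unlikely for \<open>single_one c\<close>.\<close>
  define S where "S = {b \<in> ?B. out b = Some (whole_grid n)}"
  have S: "S \<subseteq> ?B"
    by (auto simp: S_def)
  have "(1 / 25 :: real) \<le> (?D c)\<^sup>2" if "c \<in> ?C" for c
  proof -
    let ?\<phi> = "qrun ?B U (single_one c) q"
    let ?G = "{b \<in> ?B. LREC_answer n h w (single_one c) (out b)}"
    have "2 / 3 \<le> (\<Sum>b \<in> {b \<in> ?B. LREC_answer n h w zero_table (out b)}. (cmod (?\<psi> q b))\<^sup>2)"
      by (rule correct)
    also have "\<dots> \<le> (\<Sum>b\<in>S. (cmod (?\<psi> q b))\<^sup>2)"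
      using LREC_answer_zero_tableD[OF assms(1-3)]
      by (intro sum_mono2) (auto simp: S_def finite_qbasis)
    finally have \<psi>: "2 / 3 \<le> (qnorm S (?\<psi> q))\<^sup>2"
      by (simp add: qnorm_power2)
    have "\<not> LREC_answer n h w (single_one c) (Some (whole_grid n))"
      using LREC_answer_whole_gridD[of n h w "single_one c" "fst c" "snd c"] that
      by (auto simp: single_one_def)
    then have "S \<inter> ?G = {}"
      by (auto simp: S_def)
    \<comment> \<open>Disjoint sets of outcomes have total probability at most 1, so the 2/3 on
      \<open>?G\<close> leaves at most 1/3 for \<open>S\<close>.\<close>
    then have "(\<Sum>b\<in>S. (cmod (?\<phi> b))\<^sup>2) + (\<Sum>b\<in>?G. (cmod (?\<phi> b))\<^sup>2) = (\<Sum>b\<in>S \<union> ?G. (cmod (?\<phi> b))\<^sup>2)"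
      using S finite_qbasis[of n d] by (intro sum.union_disjoint[symmetric]) (auto intro: finite_subset)
    also have "\<dots> \<le> (\<Sum>b\<in>?B. (cmod (?\<phi> b))\<^sup>2)"
      using S by (intro sum_mono2) (auto simp: finite_qbasis)
    also have "\<dots> = 1"
      using qnorm_qrun[of n d q U "single_one c", OF assms(1) d U] by (simp add: qnorm_power2[symmetric])
    finally have \<phi>: "(qnorm S ?\<phi>)\<^sup>2 \<le> 1 / 3"
      using correct[of "single_one c"] by (simp add: qnorm_power2)
    \<comment> \<open>Rational bounds replace the square roots: 16/25 is below 2/3 and 9/25 above
      1/3. The gap 4/5 - 3/5 = 1/5 bounds the distance from below.\<close>
    have "(4 / 5)\<^sup>2 \<le> (qnorm S (?\<psi> q))\<^sup>2"
      using \<psi> by (simp add: power2_eq_square)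
    then have "4 / 5 \<le> qnorm S (?\<psi> q)"
      by (rule power2_le_imp_le) simp
    moreover have "(qnorm S ?\<phi>)\<^sup>2 \<le> (3 / 5)\<^sup>2"
      using \<phi> by (simp add: power2_eq_square)
    then have "qnorm S ?\<phi> \<le> 3 / 5"
      by (rule power2_le_imp_le) simp
    moreover have "qnorm S (?\<psi> q) \<le> qnorm S ?\<phi> + qnorm S (\<lambda>b. ?\<phi> b - ?\<psi> q b)"
      using qnorm_minus_le[of ?\<phi> "\<lambda>b. ?\<phi> b - ?\<psi> q b" S] by simp
    moreover have "qnorm S (\<lambda>b. ?\<phi> b - ?\<psi> q b) \<le> ?D c"
      using finite_qbasis S by (rule qnorm_mono)
    ultimately have "1 / 5 \<le> ?D c"
      by linarith
    then have "(1 / 5)\<^sup>2 \<le> (?D c)\<^sup>2"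
      by (rule power_mono) simp
    then show ?thesis
      by (simp add: power2_eq_square)
  qed
  then have "(\<Sum>c\<in>?C. 1 / 25 :: real) \<le> (\<Sum>c\<in>?C. (?D c)\<^sup>2)"
    by (rule sum_mono)
  also have "\<dots> \<le> (\<Sum>c\<in>?C. 4 * real q * (\<Sum>m<q. (qnorm (at_ones n d (single_one c)) (?\<psi> m))\<^sup>2))"
  proof (rule sum_mono)
    fix c
    let ?a = "\<lambda>m. qnorm (at_ones n d (single_one c)) (?\<psi> m)"
    have "(?D c)\<^sup>2 \<le> (2 * (\<Sum>m<q. ?a m))\<^sup>2"
      using hybrid_argument[of q n d U "single_one c"] U by (intro power_mono) auto
    also have "\<dots> = 4 * (\<Sum>m<q. ?a m)\<^sup>2"
      by (simp add: power_mult_distrib)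
    \<comment> \<open>Cauchy-Schwarz, so that squares can be summed over the cells for each query
      separately.\<close>
    also have "\<dots> \<le> 4 * ((\<Sum>m<q. (?a m)\<^sup>2) * real (card {..<q}))"
      by (intro mult_left_mono sum_squared_le_sum_of_squares) auto
    finally show "(?D c)\<^sup>2 \<le> 4 * real q * (\<Sum>m<q. (?a m)\<^sup>2)"
      by (simp add: mult_ac)
  qed
  also have "\<dots> = 4 * real q * (\<Sum>m<q. \<Sum>c\<in>?C. (qnorm (at_ones n d (single_one c)) (?\<psi> m))\<^sup>2)"
    by (subst sum.swap) (simp only: sum_distrib_left)
  \<comment> \<open>At each time the squared weights of all cells add up to the squared norm of a
    unit state.\<close>
  also have "\<dots> = 4 * real q * (\<Sum>m<q. 1)"
    using qnorm_qrun[of n d _ U zero_table, OF assms(1) d] U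
    by (simp add: sum_qnorm_at_single_one)
  \<comment> \<open>The bound \<open>n^2 / 25 <= 4 * q^2\<close> multiplied by 25; its root gives
    the constant 1/10.\<close>
  finally have "(real n)\<^sup>2 \<le> (10 * real q)\<^sup>2"
    by (simp add: power2_eq_square)
  then have "real n \<le> 10 * real q"
    by (rule power2_le_imp_le) simp
  then show ?thesis
    by simp
qed

theorem theorem10:
  fixes T :: "nat \<Rightarrow> nat"
  assumes "\<And>n. T n \<ge> 1" and "(\<lambda>n. real (T n)) \<in> O(\<lambda>_. 1)"
  shows
    "(\<exists>c>0. \<forall>n h w. 1 \<le> h \<and> h \<le> n \<and> 1 \<le> w \<and> w \<le> n \<longrightarrow>
        ereal (c * real n ^ 2) \<le> ereal_of_enat (query_complexity (T n) (deterministic_LREC n h w))) \<and>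
     (\<exists>c>0. \<forall>n h w. 1 \<le> h \<and> h \<le> n \<and> 1 \<le> w \<and> w \<le> n \<longrightarrow>
        ereal (c * real n ^ 2) \<le> ereal_of_enat (query_complexity (T n) (randomized_LREC n h w))) \<and>
     (\<exists>c>0. \<forall>n h w. 1 \<le> h \<and> h \<le> n \<and> 1 \<le> w \<and> w \<le> n \<longrightarrow>
        ereal (c * real n) \<le> ereal_of_enat (query_complexity (T n) (quantum_LREC n h w)))"
proof (intro conjI)
  show "\<exists>c>0. \<forall>n h w. 1 \<le> h \<and> h \<le> n \<and> 1 \<le> w \<and> w \<le> n \<longrightarrow>
      ereal (c * real n ^ 2) \<le> ereal_of_enat (query_complexity (T n) (deterministic_LREC n h w))"
  proof (intro exI[of _ "1 / 3"] conjI allI impI query_complexity_ge[OF assms(1)])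
    fix n h w q
    assume "1 \<le> h \<and> h \<le> n \<and> 1 \<le> w \<and> w \<le> n" and "deterministic_LREC n h w q"
    then show "1 / 3 * real n ^ 2 \<le> real q"
      by (intro randomized_LREC_ge[OF _ _ _ deterministic_imp_randomized_LREC]) auto
  qed simp
  show "\<exists>c>0. \<forall>n h w. 1 \<le> h \<and> h \<le> n \<and> 1 \<le> w \<and> w \<le> n \<longrightarrow>
      ereal (c * real n ^ 2) \<le> ereal_of_enat (query_complexity (T n) (randomized_LREC n h w))"
  proof (intro exI[of _ "1 / 3"] conjI allI impI query_complexity_ge[OF assms(1)])
    fix n h w q
    assume "1 \<le> h \<and> h \<le> n \<and> 1 \<le> w \<and> w \<le> n" and "randomized_LREC n h w q"
    then show "1 / 3 * real n ^ 2 \<le> real q"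
      by (intro randomized_LREC_ge) auto
  qed simp
  show "\<exists>c>0. \<forall>n h w. 1 \<le> h \<and> h \<le> n \<and> 1 \<le> w \<and> w \<le> n \<longrightarrow>
      ereal (c * real n) \<le> ereal_of_enat (query_complexity (T n) (quantum_LREC n h w))"
  proof (intro exI[of _ "1 / 10"] conjI allI impI query_complexity_ge[OF assms(1)])
    fix n h w q
    assume "1 \<le> h \<and> h \<le> n \<and> 1 \<le> w \<and> w \<le> n" and "quantum_LREC n h w q"
    then show "1 / 10 * real n \<le> real q"
      by (intro quantum_LREC_ge) auto
  qed simp
qed

end
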